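(* Let $0<\mu\le L$, let $f\in\mathcal{S}^2_{\mu,L}(\mathbb{R}^n)$ with minimizer $x^\star$, and let $x_0\in\mathbb{R}^n$. For any step size $0<s\le 1/L$, the solution $X=X(t)$, $t\ge 0$, of the ODE $$\ddot X(t)+2\sqrt{\mu}\,\dot X(t)+(1+\sqrt{\mu s})\nabla f(X(t))=0,\qquad X(0)=x_0,\quad \dot X(0)=-\frac{2\sqrt{s}\,\nabla f(x_0)}{1+\sqrt{\mu s}},$$ satisfies, for all $t\ge 0$, $$f(X(t))-f(x^\star)\le \frac{7\|x_0-x^\star\|^2}{2s}\,\mathrm{e}^{-\frac{\sqrt{\mu}\,t}{4}}.$$
   Context: $\|\cdot\|$ is the Euclidean norm. $\mathcal{S}^2_{\mu,L}(\mathbb{R}^n)$ is the class of convex functions $f:\mathbb{R}^n\to\mathbb{R}$ whose gradient is $L$-Lipschitz ($\|\nabla f(x)-\nabla f(y)\|\le L\|x-y\|$ for all $x,y$), whose Hessian exists and is Lipschitz continuous, and which are $\mu$-strongly convex: $f(y)\ge f(x)+\langle\nabla f(x),y-x\rangle+\frac{\mu}{2}\|y-x\|^2$ for all $x,y\in\mathbb{R}^n$. The ODE is the high-resolution ODE of Polyak's heavy-ball method. *)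

theory Defs
  imports "HOL-Analysis.Analysis"
begin

definition grad :: "(real ^ 'n \<Rightarrow> real) \<Rightarrow> real ^ 'n \<Rightarrow> real ^ 'n" where
  "grad f x = (THE g. GDERIV f x :> g)"

lemma grad_eq:
  assumes "GDERIV f x :> g"
  shows "grad f x = g"
  unfolding grad_def
proof (rule the_equality)
  fix h assume "GDERIV f x :> h"
  with assms have "(\<lambda>v. v \<bullet> h) = (\<lambda>v. v \<bullet> g)"
    unfolding gderiv_def by (blast intro: has_derivative_unique)
  then show "h = g"
    by (metis vector_eq_ldot)
qed (rule assms)

lemma GDERIV_grad:
  assumes "f differentiable (at x)"
  shows "GDERIV f x :> grad f x"
proof -
  from assms obtain f' where f': "(f has_derivative f') (at x)"
    by (auto simp: differentiable_def)
  then have "linear f'"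
    by (rule has_derivative_linear)
  then have "f' = (\<lambda>v. v \<bullet> adjoint f' 1)"
    by (simp add: adjoint_works fun_eq_iff)
  with f' have "GDERIV f x :> adjoint f' 1"
    by (simp add: gderiv_def)
  then show ?thesis
    by (simp add: grad_eq)
qed

definition hessian :: "(real ^ 'n \<Rightarrow> real) \<Rightarrow> real ^ 'n \<Rightarrow> real ^ 'n ^ 'n" where
  "hessian f x = jacobian (grad f) (at x)"

text \<open>
  The matrix type carries the Frobenius norm; since the Lipschitz constant of the Hessian is
  existentially quantified, the choice of matrix norm is immaterial. The two differentiability
  conditions are needed because \<^const>\<open>grad\<close> and \<^const>\<open>hessian\<close> are total functions.
\<close>

definition S2 :: "real \<Rightarrow> real \<Rightarrow> (real ^ 'n \<Rightarrow> real) set" where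
  "S2 \<mu> L = {f.
     convex_on UNIV f \<and>
     (\<forall>x. f differentiable (at x)) \<and>
     (\<forall>x y. norm (grad f x - grad f y) \<le> L * norm (x - y)) \<and>
     (\<forall>x. grad f differentiable (at x)) \<and>
     (\<exists>M. M-lipschitz_on UNIV (hessian f)) \<and>
     (\<forall>x y. f y \<ge> f x + grad f x \<bullet> (y - x) + \<mu> / 2 * (norm (y - x))\<^sup>2)}"

text \<open>
  \<open>V\<close> is the velocity. Derivatives are taken within \<open>{0..}\<close>, hence are one-sided at time 0, and the
  values of \<open>X\<close> at negative times are irrelevant.
\<close>

definition heavy_ball_solution ::
    "real \<Rightarrow> real \<Rightarrow> (real ^ 'n \<Rightarrow> real) \<Rightarrow> real ^ 'n \<Rightarrow> (real \<Rightarrow> real ^ 'n) \<Rightarrow> bool" where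
  "heavy_ball_solution \<mu> s f x0 X \<longleftrightarrow>
     (\<exists>V A. (\<forall>t\<ge>0. (X has_vector_derivative V t) (at t within {0..})) \<and>
            (\<forall>t\<ge>0. (V has_vector_derivative A t) (at t within {0..})) \<and>
            (\<forall>t\<ge>0. A t + (2 * sqrt \<mu>) *\<^sub>R V t + (1 + sqrt (\<mu> * s)) *\<^sub>R grad f (X t) = 0) \<and>
            X 0 = x0 \<and>
            V 0 = - ((2 * sqrt s / (1 + sqrt (\<mu> * s))) *\<^sub>R grad f x0))"

end

theory Submission
  imports Defs
begin

text \<open>
  The Lyapunov function of the proof is
  \<open>E = (1 + \<surd>(\<mu>s)) (f X - f x\<^sup>\<star>) + \<parallel>V\<parallel>\<^sup>2 / 4 + \<parallel>V + 2 \<surd>\<mu> (X - x\<^sup>\<star>)\<parallel>\<^sup>2 / 4\<close>. Along the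
  flow its derivative is \<open>- \<surd>\<mu> (\<parallel>V\<parallel>\<^sup>2 + (1 + \<surd>(\<mu>s)) \<langle>\<nabla>f X, X - x\<^sup>\<star>\<rangle>)\<close>, which strong convexity bounds
  by \<open>- \<surd>\<mu> / 4 * E\<close>, so \<open>E\<close> decays at rate \<open>\<surd>\<mu> / 4\<close>. The constant 7/2 comes from estimating \<open>E 0\<close>:
  as \<open>V 0\<close> is a negative multiple of the gradient, the cross term in the last square is nonpositive
  there, and the crude bound \<open>f x\<^sub>0 - f x\<^sup>\<star> \<le> L \<parallel>x\<^sub>0 - x\<^sup>\<star>\<parallel>\<^sup>2\<close> suffices.
\<close>

lemma grad_zero_at_min:
  fixes f :: "real ^ 'n \<Rightarrow> real"
  assumes "f differentiable (at z)" and "\<forall>x. f z \<le> f x"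
  shows "grad f z = 0"
proof -
  have "(f has_derivative (\<lambda>v. v \<bullet> grad f z)) (at z)"
    using GDERIV_grad[OF assms(1)] by (simp add: gderiv_def)
  then have "(\<lambda>v. v \<bullet> grad f z) = (\<lambda>v. 0)"
    using assms(2) by (intro differential_zero_maxmin[of z UNIV f]) auto
  then show ?thesis
    by (metis inner_eq_zero_iff)
qed

lemma GDERIV_compose_vector_derivative:
  fixes f :: "'a::real_inner \<Rightarrow> real"
  assumes "GDERIV f (X t) :> g" and "(X has_vector_derivative v) (at t within S)"
  shows "((\<lambda>t. f (X t)) has_real_derivative v \<bullet> g) (at t within S)"
proof -
  have "((\<lambda>t. f (X t)) has_derivative (\<lambda>h. (h *\<^sub>R v) \<bullet> g)) (at t within S)"
    by (rule has_derivative_compose[OF assms(2)[unfolded has_vector_derivative_def]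
          assms(1)[unfolded gderiv_def]])
  moreover have "(\<lambda>h. (h *\<^sub>R v) \<bullet> g) = (*) (v \<bullet> g)"
    by (simp add: fun_eq_iff)
  ultimately show ?thesis
    by (simp add: has_field_derivative_def)
qed

text \<open>The integrating factor \<open>exp (k * u)\<close> turns the differential inequality into
  monotonicity of \<open>H\<close>. At interior times the one-sided derivative is the ordinary one;
  time 0 enters only through continuity.\<close>

lemma exponential_decay:
  fixes E E' :: "real \<Rightarrow> real"
  assumes "\<And>t. t \<ge> 0 \<Longrightarrow> (E has_real_derivative E' t) (at t within {0..})"
    and "\<And>t. t \<ge> 0 \<Longrightarrow> E' t \<le> - k * E t"
    and "t \<ge> 0"
  shows "E t \<le> E 0 * exp (- (k * t))"
proof -
  define H where "H u = exp (k * u) * E u" for u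
  have H': "(H has_real_derivative exp (k * u) * (k * E u + E' u)) (at u within {0..})"
    if "u \<ge> 0" for u
    unfolding H_def
    by (auto intro!: derivative_eq_intros assms(1) that simp: algebra_simps)
  have "H t \<le> H 0"
  proof (rule DERIV_nonpos_imp_decreasing_open[OF assms(3)])
    fix u :: real assume u: "0 < u" "u < t"
    have "at u within {0..} = at u"
      using u by (intro at_within_interior) simp
    then have "DERIV H u :> exp (k * u) * (k * E u + E' u)"
      using H'[of u] u by simp
    moreover have "exp (k * u) * (k * E u + E' u) \<le> 0"
      using assms(2)[of u] u by (intro mult_nonneg_nonpos) auto
    ultimately show "\<exists>y. DERIV H u :> y \<and> y \<le> 0"
      by blast
  next
    have "continuous_on {0..} H"
      using H' by (intro DERIV_continuous_on) auto
    then show "continuous_on {0..t} H"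
      by (rule continuous_on_subset) auto
  qed
  then show ?thesis
    by (simp add: H_def exp_minus field_simps)
qed

text \<open>With q = \<open>sqrt (\<mu> * s)\<close>, the two terms are the shares of the squared
  velocity and of the squared distance in \<open>E 0\<close>, relative to the potential share 1. The
  bound is not sharp: 5/2 is what remains of the target 7/2.\<close>

lemma heavy_ball_initial_constant:
  fixes q :: real
  assumes "0 \<le> q" and "q \<le> 1"
  shows "2 / (1 + q) ^ 3 + q\<^sup>2 / (1 + q) \<le> 5 / 2"
proof -
  define c where "c = 1 + q"
  have c: "c \<ge> 1"
    using assms by (simp add: c_def)
  have "q\<^sup>2 \<le> q"
    using assms by (simp add: power2_eq_square mult_left_le)
  then have "q\<^sup>2 * c\<^sup>2 \<le> q * c\<^sup>2"
    by (intro mult_right_mono) auto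
  \<comment> \<open>In 5 \<open>c ^ 3\<close> the first summand, being at least 5, absorbs the 4,
    and the second absorbs the term with \<open>q\<^sup>2\<close>.\<close>
  moreover have "c ^ 3 = c\<^sup>2 + q * c\<^sup>2"
    by (simp add: c_def power2_eq_square power3_eq_cube algebra_simps)
  moreover have "c\<^sup>2 \<ge> 1" and "q * c\<^sup>2 \<ge> 0"
    using c assms by auto
  ultimately have "4 + 2 * (q\<^sup>2 * c\<^sup>2) \<le> 5 * c ^ 3"
    by linarith
  moreover have "2 / c ^ 3 + q\<^sup>2 / c = (4 + 2 * (q\<^sup>2 * c\<^sup>2)) / (2 * c ^ 3)"
    using c by (simp add: field_simps power2_eq_square power3_eq_cube)
  ultimately show ?thesis
    using c by (simp add: c_def[symmetric] divide_le_eq)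
qed

theorem theorem2:
  fixes f :: "real ^ 'n \<Rightarrow> real"
    and x0 xstar :: "real ^ 'n"
    and X :: "real \<Rightarrow> real ^ 'n"
    and \<mu> L s t :: real
  assumes "0 < \<mu>" and "\<mu> \<le> L"
    and "f \<in> S2 \<mu> L"
    and "\<forall>x. f xstar \<le> f x"
    and "0 < s" and "s \<le> 1 / L"
    and "heavy_ball_solution \<mu> s f x0 X"
    and "t \<ge> 0"
  shows "f (X t) - f xstar
           \<le> 7 * (norm (x0 - xstar))\<^sup>2 / (2 * s) * exp (- (sqrt \<mu> * t / 4))"
proof -
  define m q c where "m = sqrt \<mu>" and "q = sqrt (\<mu> * s)" and "c = 1 + q"
  have L: "L > 0"
    using assms(1,2) by linarith
  have sL: "s * L \<le> 1"
    using assms(6) L by (simp add: field_simps)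
  have m: "m > 0" "m\<^sup>2 = \<mu>"
    using assms(1) by (auto simp: m_def)
  have "\<mu> * s \<le> 1"
    using mult_right_mono[OF assms(2), of s] sL assms(5) by (simp only: mult.commute[of L]) linarith
  then have q: "0 \<le> q" "q \<le> 1" "q\<^sup>2 = \<mu> * s"
    using assms(1,5) by (auto simp: q_def)
  have c: "c \<ge> 1"
    using q by (simp add: c_def)
  have diff: "f differentiable (at x)" for x
    using assms(3) by (simp add: S2_def)
  have lip: "norm (grad f x - grad f y) \<le> L * norm (x - y)" for x y
    using assms(3) by (simp add: S2_def)
  have strong: "f x - f xstar + \<mu> / 2 * (norm (x - xstar))\<^sup>2 \<le> grad f x \<bullet> (x - xstar)" for x
  proof -
    have "f x + grad f x \<bullet> (xstar - x) + \<mu> / 2 * (norm (xstar - x))\<^sup>2 \<le> f xstar"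
      using assms(3) by (simp add: S2_def)
    then show ?thesis
      by (simp add: inner_diff_right norm_minus_commute)
  qed
  have grad_bound: "norm (grad f x) \<le> L * norm (x - xstar)" for x
    using lip[of x xstar] grad_zero_at_min[OF diff assms(4)] by simp
  obtain V A where
      X': "\<And>t. t \<ge> 0 \<Longrightarrow> (X has_vector_derivative V t) (at t within {0..})"
    and V': "\<And>t. t \<ge> 0 \<Longrightarrow> (V has_vector_derivative A t) (at t within {0..})"
    and ode: "\<And>t. t \<ge> 0 \<Longrightarrow> A t + (2 * m) *\<^sub>R V t + c *\<^sub>R grad f (X t) = 0"
    and X0: "X 0 = x0"
    and V0: "V 0 = - ((2 * sqrt s / c) *\<^sub>R grad f x0)"
    using assms(7) unfolding heavy_ball_solution_def m_def c_def q_def by blast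
  define D where "D t = X t - xstar" for t
  \<comment> \<open>The shift by \<open>2 * m\<close> times \<open>D\<close> absorbs the friction:
    by the ODE, the derivative of \<open>W\<close> is just \<open>-c\<close> times the
    gradient.\<close>
  define W where "W t = V t + (2 * m) *\<^sub>R D t" for t
  define E where "E t = c * (f (X t) - f xstar) + (V t \<bullet> V t) / 4 + (W t \<bullet> W t) / 4" for t
  define E' where "E' t = - m * (V t \<bullet> V t + c * (D t \<bullet> grad f (X t)))" for t

  have E_deriv: "(E has_real_derivative E' u) (at u within {0..})" if u: "u \<ge> 0" for u
  proof -
    have W': "(W has_vector_derivative A u + (2 * m) *\<^sub>R V u) (at u within {0..})"
      unfolding W_def D_def
      using has_vector_derivative_add[OF V'[OF u] has_vector_derivative_scaleR[OF DERIV_const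
          has_vector_derivative_diff[OF X'[OF u] has_vector_derivative_const]]]
      by simp
    have F': "((\<lambda>t. f (X t) - f xstar) has_real_derivative V u \<bullet> grad f (X u))
        (at u within {0..})"
      using DERIV_diff[OF GDERIV_compose_vector_derivative[where f = f and X = X,
            OF GDERIV_grad[OF diff] X'[OF u]] DERIV_const[of "f xstar"]]
      by simp
    have sq: "((\<lambda>t. Z t \<bullet> Z t) has_real_derivative 2 * (Z u \<bullet> z)) (at u within {0..})"
      if "(Z has_vector_derivative z) (at u within {0..})" for Z :: "real \<Rightarrow> real ^ 'n" and z
    proof -
      have "GDERIV (\<lambda>x. x \<bullet> x) (Z u) :> 2 *\<^sub>R Z u"
        unfolding gderiv_def
        by (auto intro!: derivative_eq_intros simp: inner_add_right inner_commute)
      from GDERIV_compose_vector_derivative[OF this that] show ?thesis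
        by (simp add: inner_add_right inner_commute)
    qed
    have AW: "A u + (2 * m) *\<^sub>R V u = - (c *\<^sub>R grad f (X u))"
      using ode[OF u] by (simp only: eq_neg_iff_add_eq_0)
    then have A: "A u = - (c *\<^sub>R grad f (X u)) - (2 * m) *\<^sub>R V u"
      by (simp only: eq_diff_eq)
    have "(E has_real_derivative c * (V u \<bullet> grad f (X u)) + 2 * (V u \<bullet> A u) / 4
            + 2 * (W u \<bullet> (A u + (2 * m) *\<^sub>R V u)) / 4) (at u within {0..})"
      unfolding E_def
      by (intro DERIV_add DERIV_cdivide DERIV_cmult F' sq[OF V'[OF u]] sq[OF W'])
    also have "c * (V u \<bullet> grad f (X u)) + 2 * (V u \<bullet> A u) / 4
            + 2 * (W u \<bullet> (A u + (2 * m) *\<^sub>R V u)) / 4 = E' u"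
      \<comment> \<open>\<open>AW\<close> must rewrite the whole sum before \<open>A\<close> expands
        the acceleration. Each square then contributes minus half of
        \<open>c * (V u \<bullet> grad f (X u))\<close>, cancelling the derivative of the potential
        term.\<close>
      unfolding AW unfolding A W_def E'_def
      by (simp add: inner_diff_right inner_add_left field_simps)
    finally show ?thesis .
  qed
  \<comment> \<open>The cross term stays explicit: the decay estimate bounds it for every time,
    while at time 0 its sign is used.\<close>
  have WW_eq: "W u \<bullet> W u = V u \<bullet> V u + 2 * (2 * m * (V u \<bullet> D u)) + 4 * (\<mu> * (D u \<bullet> D u))" for u
    unfolding m(2)[symmetric]
    by (simp add: W_def inner_add_left inner_add_right inner_commute power2_eq_square
        algebra_simps)
  have E_decay: "E' u \<le> - (m / 4) * E u" for u
  proof -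
    let ?F = "f (X u) - f xstar"
    have "2 * m * (V u \<bullet> D u) \<le> V u \<bullet> V u + \<mu> * (D u \<bullet> D u)"
      using inner_ge_zero[of "V u - m *\<^sub>R D u"] unfolding m(2)[symmetric]
      by (simp add: inner_diff_left inner_diff_right inner_commute power2_eq_square algebra_simps)
    then have WW: "W u \<bullet> W u \<le> 3 * (V u \<bullet> V u) + 6 * (\<mu> * (D u \<bullet> D u))"
      unfolding WW_eq by linarith
    have F: "0 \<le> c * ?F"
      using c assms(4) by simp
    have DD: "0 \<le> \<mu> * (D u \<bullet> D u)"
      using assms(1) by simp
    have "c * ?F + c * (\<mu> * (D u \<bullet> D u) / 2) = c * (?F + \<mu> / 2 * (D u \<bullet> D u))"
      by (simp add: algebra_simps)
    also have "\<dots> \<le> c * (D u \<bullet> grad f (X u))"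
      using strong[of "X u"] c
      by (intro mult_left_mono) (auto simp: D_def power2_norm_eq_inner inner_commute)
    finally have "c * ?F + c * (\<mu> * (D u \<bullet> D u) / 2) \<le> c * (D u \<bullet> grad f (X u))" .
    moreover have "\<mu> * (D u \<bullet> D u) / 2 \<le> c * (\<mu> * (D u \<bullet> D u) / 2)"
      using mult_right_mono[OF c, of "\<mu> * (D u \<bullet> D u) / 2"] DD by simp
    \<comment> \<open>By \<open>WW\<close>, E/4 is at most a quarter of the potential term, a
      quarter of the squared speed and 3/8 of \<open>\<mu> * (D u \<bullet> D u)\<close>; strong
      convexity with c at least 1 supplies 1/2 of the latter, which fixes the rate 1/4.\<close>
    ultimately have "E u / 4 \<le> V u \<bullet> V u + c * (D u \<bullet> grad f (X u))"
      using WW F DD inner_ge_zero[of "V u"] unfolding E_def by argo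
    from mult_left_mono[OF this, of m] m(1) show ?thesis
      by (simp add: E'_def)
  qed
  have decay: "E t \<le> E 0 * exp (- (m / 4 * t))"
    by (rule exponential_decay[of E E']) (use E_deriv E_decay assms(8) in auto)

  let ?R = "(norm (x0 - xstar))\<^sup>2"
  \<comment> \<open>The factor \<open>c\<close> is kept because \<open>E\<close> dominates
    \<open>c * (f (X t) - f xstar)\<close>; it cancels at the end.\<close>
  have "E 0 \<le> c * (7 * ?R / (2 * s))"
  proof -
    have g: "norm (grad f x0) \<le> L * norm (x0 - xstar)"
      by (rule grad_bound)
    have Dg_nonneg: "0 \<le> D 0 \<bullet> grad f x0"
    proof -
      have "0 \<le> f x0 - f xstar + \<mu> / 2 * ?R"
        using assms(1,4) by simp
      also have "\<dots> \<le> D 0 \<bullet> grad f x0"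
        using strong[of x0] by (simp add: D_def X0 inner_commute)
      finally show ?thesis .
    qed
    have "f x0 - f xstar \<le> grad f x0 \<bullet> (x0 - xstar)"
      using strong[of x0] assms(1) by (smt (verit) mult_nonneg_nonneg zero_le_power2 divide_nonneg_pos)
    also have "\<dots> \<le> norm (grad f x0) * norm (x0 - xstar)"
      by (rule norm_cauchy_schwarz)
    also have "\<dots> \<le> L * norm (x0 - xstar) * norm (x0 - xstar)"
      using g by (intro mult_right_mono) auto
    also have "\<dots> = L * ?R"
      by (simp add: power2_eq_square)
    also have "\<dots> \<le> 1 / s * ?R"
      using sL assms(5) by (intro mult_right_mono) (auto simp: field_simps)
    finally have F0: "f x0 - f xstar \<le> ?R / s"
      by simp
    have VV: "V 0 \<bullet> V 0 \<le> 4 / (c\<^sup>2 * s) * ?R"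
    proof -
      have "V 0 \<bullet> V 0 = 4 * s / c\<^sup>2 * (norm (grad f x0))\<^sup>2"
        using assms(5) unfolding power2_norm_eq_inner[symmetric] V0
        by (simp add: power_mult_distrib power_divide)
      also have "\<dots> \<le> 4 * s / c\<^sup>2 * (L * norm (x0 - xstar))\<^sup>2"
        using g assms(5) by (intro mult_left_mono power_mono) auto
      \<comment> \<open>Regrouping isolates \<open>s * L\<close>, which the step size restriction
        bounds by 1.\<close>
      also have "\<dots> = 4 / (c\<^sup>2 * s) * ((s * L)\<^sup>2 * ?R)"
        using assms(5) by (simp add: power2_eq_square)
      also have "\<dots> \<le> 4 / (c\<^sup>2 * s) * (1 * ?R)"
        using sL assms(5) L by (intro mult_left_mono mult_right_mono) (auto intro: power_le_one)
      finally show ?thesis by simp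
    qed
    have "V 0 \<bullet> D 0 \<le> 0"
      using c assms(5) Dg_nonneg by (simp add: V0 inner_commute)
    then have "m * (V 0 \<bullet> D 0) \<le> 0"
      using m by (simp add: mult_nonneg_nonpos)
    moreover have "D 0 \<bullet> D 0 = ?R"
      by (simp add: D_def X0 power2_norm_eq_inner)
    ultimately have "E 0 \<le> c * (f x0 - f xstar) + V 0 \<bullet> V 0 / 2 + \<mu> * ?R"
      unfolding E_def X0 WW_eq by (simp add: field_simps)
    also have "\<dots> \<le> c * (?R / s) + (4 / (c\<^sup>2 * s) * ?R) / 2 + \<mu> * ?R"
      using F0 VV c assms(1) by (intro add_mono mult_left_mono divide_right_mono) auto
    \<comment> \<open>Since \<open>q\<^sup>2\<close> is \<open>\<mu> * s\<close>, the last summand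
      is also a multiple of \<open>?R / s\<close>, so all three share the factor
      \<open>c * ?R / s\<close>.\<close>
    also have "\<dots> = c * (?R / s * (1 + (2 / c ^ 3 + q\<^sup>2 / c)))"
      using c assms(5) unfolding q(3)
      by (simp add: field_simps power2_eq_square power3_eq_cube)
    also have "\<dots> \<le> c * (?R / s * (1 + 5 / 2))"
      using heavy_ball_initial_constant[OF q(1,2)] c assms(5)
      by (intro mult_left_mono add_mono) (auto simp: c_def)
    finally show ?thesis
      by simp
  qed
  then have "E 0 * exp (- (m / 4 * t)) \<le> c * (7 * ?R / (2 * s)) * exp (- (m / 4 * t))"
    by (intro mult_right_mono) auto
  with decay have "E t \<le> c * (7 * ?R / (2 * s) * exp (- (m / 4 * t)))"
    by (simp add: mult.assoc)
  moreover have "c * (f (X t) - f xstar) \<le> E t"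
    by (simp add: E_def)
  ultimately have "c * (f (X t) - f xstar) \<le> c * (7 * ?R / (2 * s) * exp (- (m / 4 * t)))"
    by linarith
  then have "f (X t) - f xstar \<le> 7 * ?R / (2 * s) * exp (- (m / 4 * t))"
    by (rule mult_left_le_imp_le) (use c in simp)
  then show ?thesis
    by (simp add: m_def)
qed

end
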